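(* For every complex number $s$ with $\Re(s)>-3$, $$\iint_{[0,1]^2}\frac{1-x}{1+xy}(-\ln xy)^s\,dx\,dy = \Gamma(s+2)\left[\zeta^*(s+2)+\frac{1-2\zeta^*(s+1)}{s+1}\right],$$ where $\zeta^*$ is the alternating zeta function, and where at the points $s=-1$ and $s=-2$ the right-hand side is understood as its limit (i.e. as the value of its analytic extension at these removable singularities).
   Context: The alternating zeta function $\zeta^*$ is the entire function obtained by analytic continuation of the convergent Dirichlet series $\zeta^*(s)=1-\frac{1}{2^s}+\frac{1}{3^s}-\cdots$ for $\Re(s)>0$. It is related to the Riemann zeta function $\zeta$ by $\zeta^*(s)=(1-2^{1-s})\zeta(s)$. The gamma function is $\Gamma(s)=\int_0^\infty e^{-t}t^{s-1}\,dt$ for $\Re(s)>0$, analytically continued for $\Re(s)>-1$, $s\neq 0$, by $\Gamma(s)=\Gamma(s+1)/s$. Here $\ln$ is the natural logarithm, $\ln xy$ means $\ln(xy)$, and for $0<x,y<1$ the power $(-\ln xy)^s$ of the positive real number $-\ln(xy)$ is $\exp(s\ln(-\ln(xy)))$. The integrand is defined for $0<x<1$, $0<y<1$, i.e. almost everywhere on the unit square. *)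

theory Defs
  imports "HOL-Complex_Analysis.Complex_Analysis"
begin

text \<open>
  The alternating zeta function: the unique entire function extending the Dirichlet series.
  The term with index \<open>n\<close> is \<open>(-1) ^ n / (n + 1) ^ s\<close>.
\<close>

definition alt_zeta :: "complex \<Rightarrow> complex" where
  "alt_zeta = (THE f. f holomorphic_on UNIV \<and>
     (\<forall>s. Re s > 0 \<longrightarrow> (\<lambda>n. (-1) ^ n / of_nat (Suc n) powr s) sums f s))"

text \<open>
  For \<open>0 < x < 1\<close> and \<open>0 < y < 1\<close> the base \<open>- ln (x * y)\<close> is a positive real, so the principal
  branch used by \<open>powr\<close> gives \<open>exp (s * ln (- ln (x * y)))\<close>. On the boundary of the unit
  square, a null set, the values are arbitrary and do not affect the integral.
\<close>

definition square_integrand :: "complex \<Rightarrow> real \<times> real \<Rightarrow> complex" where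
  "square_integrand s = (\<lambda>(x, y).
     of_real ((1 - x) / (1 + x * y)) * of_real (- ln (x * y)) powr s)"

text \<open>
  In the half-plane \<open>Re s > -3\<close> this expression has the intended value except at the points
  \<open>-1\<close> (division by zero) and \<open>-2\<close> (pole of the Gamma function), where only its limit
  is meaningful.
\<close>

definition gamma_zeta_expr :: "complex \<Rightarrow> complex" where
  "gamma_zeta_expr s =
     Gamma (s + 2) * (alt_zeta (s + 2) + (1 - 2 * alt_zeta (s + 1)) / (s + 1))"

end

theory Submission
  imports Defs "HOL-Probability.Probability" "HOL-Real_Asymp.Real_Asymp"
begin

text \<open>
  If \<open>x\<close> and \<open>y\<close> are uniformly distributed on the unit interval, then \<open>- ln x\<close> and \<open>- ln y\<close> are
  independent exponential variables. A convolution therefore shows that the map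
  \<open>(x, y) \<mapsto> - ln (x y)\<close> carries the measure \<open>(1 - x) dx dy\<close> to
  \<open>exp (- u) (u - 1 + exp (- u)) du\<close> on the positive half-line
  (\<open>distr_square_neg_ln_mult\<close>). The double integral becomes
  \[ J(s) = \int_0^\infty u^s\, w(u)\,(u - 1 + e^{-u})\,du, \qquad w(u) = \frac{1}{e^u + 1}, \]
  which is a Mellin transform (\<open>square_integral_eq_mellin_fermi_kernel\<close>). Its kernel is bounded by
  \<open>u\<^sup>2 exp (- u)\<close>, so the integral converges absolutely and is holomorphic for \<open>Re s > -3\<close>
  (\<open>mellin_integrable\<close>, \<open>mellin_holomorphic\<close>).

  For \<open>Re s > -1\<close> the identity \<open>w(u) (1 - exp (- u)) = 2 w(u) - exp (- u)\<close> splits \<open>J\<close> into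
  \<open>\<Gamma>(s + 2) \<zeta>\<^sup>*(s + 2) - 2 \<Gamma>(s + 1) \<zeta>\<^sup>*(s + 1) + \<Gamma>(s + 1)\<close>, because the Mellin transform of \<open>w\<close> is
  \<open>\<Gamma>(s) \<zeta>\<^sup>*(s)\<close> (\<open>mellin_fermi\<close>). By \<open>\<Gamma>(s + 2) = (s + 1) \<Gamma>(s + 1)\<close> this is the right-hand side. The
  identity theorem extends the equality to \<open>Re s > -3\<close> without \<open>-1\<close> and \<open>-2\<close>, and the
  continuity of \<open>J\<close> gives the limits at these two points.

  It also has to be shown that the alternating zeta function exists as an entire function. All
  derivatives of \<open>w\<close> are polynomials in \<open>w\<close> without constant term, so repeated integration by parts
  continues \<open>1 / \<Gamma>(s)\<close> times the Mellin transform of \<open>w\<close> to every half-plane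
  (\<open>rGamma_mellin_poly_fermi_extends\<close>).
\<close>

section \<open>Mellin transforms of exponentially decaying functions\<close>

text \<open>
  The Mellin transform \<open>\<integral>\<^sub>0\<^sup>\<infinity> u\<^sup>s\<^sup>-\<^sup>1 h(u) du\<close>, with values in the complex numbers; it is only
  meaningful where the integral converges absolutely.
\<close>

definition mellin :: "(real \<Rightarrow> complex) \<Rightarrow> complex \<Rightarrow> complex" where
  "mellin h s = (LINT u:{0<..}|lborel. of_real u powr (s - 1) * h u)"

text \<open>
  On the positive half-line, away from the branch cut, the complex power is continuous.
\<close>

lemma measurable_powr_pos [measurable]:
  "(\<lambda>u::real. indicator {0<..} u *\<^sub>R (complex_of_real u powr z)) \<in> borel_measurable borel"
  by (intro borel_measurable_continuous_on_indicator continuous_intros) (auto simp: complex_nonpos_Reals_iff)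

lemma norm_of_real_powr:
  "u > 0 \<Longrightarrow> norm (complex_of_real u powr z) = u powr Re z"
  by (subst norm_powr_real_powr) auto

lemma set_borel_measurable_mellin:
  assumes [measurable]: "h \<in> borel_measurable borel"
  shows "set_borel_measurable lborel {0<..} (\<lambda>u. complex_of_real u powr z * h u)"
proof -
  have "(\<lambda>u. (indicator {0<..} u *\<^sub>R (complex_of_real u powr z)) * h u) \<in> borel_measurable lborel"
    by measurable
  thus ?thesis
    unfolding set_borel_measurable_def by simp
qed

lemma not_nonpos_Int_if_Re_pos: "Re z > 0 \<Longrightarrow> (z :: complex) \<notin> \<int>\<^sub>\<le>\<^sub>0"
  using nonpos_Ints_subset_nonpos_Reals by (auto simp: complex_nonpos_Reals_iff)

lemma set_integrable_Gamma:
  assumes "Re s > 0"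
  shows "set_integrable lborel {0<..} (\<lambda>u. complex_of_real u powr (s - 1) * of_real (exp (- u)))"
proof -
  have meas: "set_borel_measurable lborel {0<..} (\<lambda>u. complex_of_real u powr (s - 1) * of_real (exp (- u)))"
    by (rule set_borel_measurable_mellin) measurable
  have "set_integrable lebesgue {0<..} (\<lambda>u. complex_of_real u powr (s - 1) * of_real (exp (- u)))"
    using absolutely_integrable_Gamma_integral'[OF assms] by (simp add: exp_minus field_simps)
  thus ?thesis
    using meas unfolding set_integrable_def set_borel_measurable_def
    by (subst (asm) integrable_completion) auto
qed

lemma mellin_exp: 
  assumes "Re s > 0"
  shows "mellin (\<lambda>u. of_real (exp (- u))) s = Gamma s"
proof -
  have "((\<lambda>u. complex_of_real u powr (s - 1) * of_real (exp (- u))) has_integral Gamma s) {0<..}"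
    using Gamma_integral_complex'[OF assms] by (simp add: exp_minus field_simps)
  thus ?thesis
    unfolding mellin_def using set_borel_integral_eq_integral(2)[OF set_integrable_Gamma[OF assms]]
    by (simp add: integral_unique)
qed

lemma mellin_integrable:
  assumes [measurable]: "h \<in> borel_measurable borel"
    and bound: "\<And>u. u > 0 \<Longrightarrow> norm (h u) \<le> C * u powr a * exp (- u)"
    and s: "Re s > - a"
  shows "set_integrable lborel {0<..} (\<lambda>u. complex_of_real u powr (s - 1) * h u)"
proof (rule set_integrable_bound)
  show "set_integrable lborel {0<..} 
      (\<lambda>u. of_real C * (complex_of_real u powr (s + of_real a - 1) * of_real (exp (- u))))"
    by (intro set_integrable_mult_right set_integrable_Gamma) (use s in auto)
  show "set_borel_measurable lborel {0<..} (\<lambda>u. complex_of_real u powr (s - 1) * h u)"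
    by (rule set_borel_measurable_mellin) fact
  have "norm (complex_of_real u powr (s - 1) * h u)
      \<le> norm (of_real C * (complex_of_real u powr (s + of_real a - 1) * of_real (exp (- u))))"
    if u: "u > 0" for u
  proof -
    have "norm (complex_of_real u powr (s - 1) * h u) \<le> u powr (Re s - 1) * (C * u powr a * exp (-u))"
      unfolding norm_mult using u bound by (intro mult_mono) (auto simp: norm_of_real_powr)
    also have "\<dots> = C * (u powr (Re s + a - 1) * exp (-u))"
      by (simp add: powr_add powr_diff powr_minus)
    also have "\<dots> \<le> \<bar>C\<bar> * (u powr (Re s + a - 1) * exp (-u))"
      by (intro mult_right_mono) auto
    also have "\<dots> = norm (of_real C * (complex_of_real u powr (s + of_real a - 1) * of_real (exp (- u))))"
      using u by (simp add: norm_mult norm_of_real_powr)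
    finally show ?thesis .
  qed
  thus "AE u in lborel. u \<in> {0<..} \<longrightarrow> norm (complex_of_real u powr (s - 1) * h u)
      \<le> norm (of_real C * (complex_of_real u powr (s + of_real a - 1) * of_real (exp (- u))))"
    by auto
qed

text \<open>
  This bound, uniform in \<open>w\<close>, lets dominated convergence differentiate a Mellin transform under
  the integral sign. It follows from
  \<open>|exp z - 1| \<le> |z| exp |Re z|\<close> with \<open>z = w ln u\<close>; the remaining factor \<open>|ln u|\<close> costs
  another \<open>exp (d |ln u|) / d\<close>, and \<open>exp (2 d |ln u|)\<close> is one of \<open>u powr (2 d)\<close>, \<open>u powr (- 2 d)\<close>.
\<close>

lemma powr_difference_quotient_bound:
  assumes u: "u > 0" and d: "d > 0" and w: "w \<noteq> 0" "norm w \<le> d"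
  shows "norm ((complex_of_real u powr (z + w) - complex_of_real u powr z) / w)
           \<le> (u powr (Re z + 2 * d) + u powr (Re z - 2 * d)) / d"
proof -
  define l where "l = \<bar>ln u\<bar>"
  have l0: "l \<ge> 0" by (simp add: l_def)
  have Ln: "complex_of_real u powr w = exp (w * of_real (ln u))"
    using u by (simp add: powr_def Ln_of_real)
  have "complex_of_real u powr (z + w) - complex_of_real u powr z
      = complex_of_real u powr z * (exp (w * of_real (ln u)) - 1)"
    by (simp add: powr_add Ln algebra_simps)
  hence "norm ((complex_of_real u powr (z + w) - complex_of_real u powr z) / w)
     = u powr Re z * (norm (exp (w * of_real (ln u)) - 1) / norm w)"
    using u by (simp add: norm_mult norm_divide norm_of_real_powr)
  also have "\<dots> \<le> u powr Re z * ((u powr (2 * d) + u powr (- 2 * d)) / d)"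
  proof (rule mult_left_mono)
    have "norm (exp (w * of_real (ln u)) - 1) 
        \<le> exp \<bar>Re (w * of_real (ln u))\<bar> * norm (w * of_real (ln u))"
      using Taylor_exp[of "w * of_real (ln u)" 0] by simp
    also have "\<dots> \<le> exp (d * l) * (norm w * l)"
    proof (intro mult_mono)
      have "\<bar>Re w\<bar> * \<bar>ln u\<bar> \<le> d * l"
        unfolding l_def using w abs_Re_le_cmod[of w] by (intro mult_mono) auto
      thus "exp \<bar>Re (w * of_real (ln u))\<bar> \<le> exp (d * l)"
        by (simp add: abs_mult)
    qed (auto simp: norm_mult l_def)
    finally have "norm (exp (w * of_real (ln u)) - 1) / norm w \<le> exp (d * l) * l"
      using w by (simp add: divide_simps mult_ac)
    also have "\<dots> \<le> exp (d * l) * (exp (d * l) / d)"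
      using exp_ge_add_one_self[of "d * l"] d
      by (intro mult_left_mono) (auto simp: pos_le_divide_eq mult.commute simp del: exp_ge_add_one_self)
    also have "\<dots> = exp (2 * d * l) / d"
      by (simp flip: exp_add)
    also have "\<dots> \<le> (u powr (2 * d) + u powr (- 2 * d)) / d"
      using u d by (intro divide_right_mono) (auto simp: l_def powr_def abs_if)
    finally show "norm (exp (w * of_real (ln u)) - 1) / norm w \<le> (u powr (2 * d) + u powr (- 2 * d)) / d" .
  qed simp
  also have "\<dots> = (u powr (Re z + 2 * d) + u powr (Re z - 2 * d)) / d"
    by (simp add: powr_add powr_diff powr_minus field_simps)
  finally show ?thesis .
qed

lemma mellin_holomorphic:
  assumes [measurable]: "h \<in> borel_measurable borel"
    and bound: "\<And>u. u > 0 \<Longrightarrow> norm (h u) \<le> C * u powr a * exp (- u)"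
  shows "mellin h holomorphic_on {s. Re s > - a}"
proof (rule holomorphic_onI)
  fix s assume "s \<in> {s. Re s > - a}"
  hence s: "Re s > - a" by simp
  \<comment> \<open>A third of the distance to the boundary: the majorant needs the exponents \<open>Re s - 2 d\<close> and \<open>Re s + 2 d\<close>.\<close>
  define d where "d = (Re s + a) / 3"
  have d: "d > 0" using s by (simp add: d_def)
  note integrable = mellin_integrable[OF assms]
  define D where "D = (\<lambda>u. indicator {0<..} u *\<^sub>R (of_real (ln u) * complex_of_real u powr (s - 1) * h u))"
  define Q where "Q = (\<lambda>z u. indicator {0<..} u *\<^sub>R
      ((complex_of_real u powr (z - 1) - complex_of_real u powr (s - 1)) / (z - s) * h u))"
  define B where "B = (\<lambda>u. indicator {0<..} u *\<^sub>R (norm (complex_of_real u powr (s + of_real (2 * d) - 1) * h u) / d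
     + norm (complex_of_real u powr (s - of_real (2 * d) - 1) * h u) / d))"
  have Qint: "(mellin h z - mellin h s) / (z - s) = integral\<^sup>L lborel (Q z)" if "Re z > - a" for z
  proof -
    have "mellin h z - mellin h s = (LINT u:{0<..}|lborel. complex_of_real u powr (z - 1) * h u
        - complex_of_real u powr (s - 1) * h u)"
      unfolding mellin_def
      by (intro set_integral_diff(2)[symmetric] integrable that s)
    also have "\<dots> / (z - s) = (LINT u:{0<..}|lborel. (complex_of_real u powr (z - 1) * h u
        - complex_of_real u powr (s - 1) * h u) / (z - s))"
      by simp
    also have "\<dots> = integral\<^sup>L lborel (Q z)"
      unfolding set_lebesgue_integral_def Q_def
      by (intro Bochner_Integration.integral_cong) (auto simp: diff_divide_distrib algebra_simps)
    finally show ?thesis .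
  qed
  have Dmeas: "D \<in> borel_measurable lborel"
  proof -
    have "(\<lambda>u. of_real (ln u) * (indicator {0<..} u *\<^sub>R (complex_of_real u powr (s - 1))) * h u) \<in> borel_measurable lborel"
      by measurable
    thus ?thesis unfolding D_def by (simp add: mult_ac)
  qed
  have Qmeas: "Q z \<in> borel_measurable lborel" for z
  proof -
    have "(\<lambda>u. ((indicator {0<..} u *\<^sub>R (complex_of_real u powr (z - 1))) - 
       (indicator {0<..} u *\<^sub>R (complex_of_real u powr (s - 1)))) / (z - s) * h u) \<in> borel_measurable lborel"
      by measurable
    also have "(\<lambda>u. ((indicator {0<..} u *\<^sub>R (complex_of_real u powr (z - 1))) - 
       (indicator {0<..} u *\<^sub>R (complex_of_real u powr (s - 1)))) / (z - s) * h u) = Q z"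
      by (auto simp: Q_def indicator_def)
    finally show ?thesis .
  qed
  have Bint: "integrable lborel B"
  proof -
    have "set_integrable lborel {0<..} (\<lambda>u. norm (complex_of_real u powr (s + of_real (2 * d) - 1) * h u) / d
     + norm (complex_of_real u powr (s - of_real (2 * d) - 1) * h u) / d)"
      using s d by (intro set_integral_add(1) set_integrable_divide set_integrable_norm integrable)
         (auto simp: d_def field_simps)
    thus ?thesis by (simp add: set_integrable_def B_def)
  qed
  have QB: "norm (Q z u) \<le> B u" if "norm (z - s) \<le> d" "z \<noteq> s" for z u
  proof (cases "u > 0")
    case True
    have "norm (Q z u) = norm ((complex_of_real u powr ((s - 1) + (z - s)) - complex_of_real u powr (s - 1)) / (z - s)) * norm (h u)"
      using True by (simp add: Q_def norm_mult norm_divide)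
    also have "\<dots> \<le> (u powr (Re (s - 1) + 2 * d) + u powr (Re (s - 1) - 2 * d)) / d * norm (h u)"
      by (intro mult_right_mono powr_difference_quotient_bound) (use True d that in auto)
    also have "\<dots> = B u"
      using True by (simp add: B_def norm_mult norm_of_real_powr add_divide_distrib algebra_simps)
    finally show ?thesis .
  qed (auto simp: Q_def B_def)
  have Qlim: "(\<lambda>n. Q (X n) u) \<longlonglongrightarrow> D u" if X: "X \<longlonglongrightarrow> s" "\<And>n. X n \<noteq> s" for X u
  proof (cases "u > 0")
    case True
    have "((\<lambda>z. complex_of_real u powr (z - 1)) has_field_derivative 
       Ln (of_real u) * complex_of_real u powr (s - 1) * 1) (at s)"
      by (rule DERIV_chain2[where f = "(powr) (complex_of_real u)" and g = "\<lambda>z. z - 1"])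
         (use True in \<open>auto intro!: derivative_eq_intros\<close>)
    hence "((\<lambda>z. (complex_of_real u powr (z - 1) - complex_of_real u powr (s - 1)) / (z - s))
             \<longlongrightarrow> of_real (ln u) * complex_of_real u powr (s - 1)) (at s)"
      using True by (simp add: has_field_derivative_iff Ln_of_real)
    hence "(\<lambda>n. (complex_of_real u powr (X n - 1) - complex_of_real u powr (s - 1)) / (X n - s))
             \<longlonglongrightarrow> of_real (ln u) * complex_of_real u powr (s - 1)"
      using X by (auto simp: tendsto_at_iff_sequentially o_def)
    hence "(\<lambda>n. (complex_of_real u powr (X n - 1) - complex_of_real u powr (s - 1)) / (X n - s) * h u)
             \<longlonglongrightarrow> of_real (ln u) * complex_of_real u powr (s - 1) * h u"
      by (intro tendsto_intros)
    thus ?thesis using True by (simp add: Q_def D_def)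
  qed (auto simp: Q_def D_def)
  \<comment> \<open>Within the ball the majorant \<open>B\<close> applies to every member of a sequence tending to \<open>s\<close>.\<close>
  have "((\<lambda>z. (mellin h z - mellin h s) / (z - s)) \<longlongrightarrow> integral\<^sup>L lborel D) (at s within ball s d)"
    unfolding tendsto_at_iff_sequentially o_def
  proof safe
    fix X :: "nat \<Rightarrow> complex" 
    assume X: "\<forall>i. X i \<in> ball s d - {s}" "X \<longlonglongrightarrow> s"
    have ReX: "Re (X n) > - a" for n
      using X(1) d abs_Re_le_cmod[of "X n - s"] by (auto simp: dist_norm norm_minus_commute d_def dest: spec[of _ n])
    have "(\<lambda>n. integral\<^sup>L lborel (Q (X n))) \<longlonglongrightarrow> integral\<^sup>L lborel D"
    proof (rule integral_dominated_convergence[where w = B])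
      show "AE u in lborel. norm (Q (X n) u) \<le> B u" for n
        using X(1) by (auto intro!: QB simp: dist_norm norm_minus_commute dest!: spec[of _ n])
    qed (use X Dmeas Qmeas Bint Qlim in auto)
    thus "(\<lambda>n. (mellin h (X n) - mellin h s) / (X n - s)) \<longlonglongrightarrow> integral\<^sup>L lborel D"
      using ReX by (simp add: Qint)
  qed
  hence "(mellin h has_field_derivative integral\<^sup>L lborel D) (at s)"
    using d by (simp add: has_field_derivative_iff at_within_open[of s "ball s d"])
  thus "mellin h field_differentiable at s within {s. Re s > - a}"
    using field_differentiable_at_within field_differentiable_def by blast
qed

lemma mellin_exp_scaled: 
  assumes s: "Re s > 0" and c: "c > 0"
  shows "mellin (\<lambda>u. of_real (exp (- c * u))) s = Gamma s / of_real c powr s"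
proof -
  have "Gamma s = (\<integral>u. indicator {0<..} u *\<^sub>R (complex_of_real u powr (s - 1) * of_real (exp (- u))) \<partial>lborel)"
    using mellin_exp[OF s] by (simp add: mellin_def set_lebesgue_integral_def)
  also have "\<dots> = c *\<^sub>R (\<integral>u. indicator {0<..} (c * u) *\<^sub>R 
        (complex_of_real (c * u) powr (s - 1) * of_real (exp (- (c * u)))) \<partial>lborel)"
    using c by (subst lborel_integral_real_affine[of c _ 0]) auto
  also have "(\<lambda>u. indicator {0<..} (c * u) *\<^sub>R 
        (complex_of_real (c * u) powr (s - 1) * of_real (exp (- (c * u))))) =
      (\<lambda>u. of_real c powr (s - 1) * (indicator {0<..} u *\<^sub>R (complex_of_real u powr (s - 1) * of_real (exp (- c * u)))))"
    using c by (auto simp: fun_eq_iff indicator_def zero_less_mult_iff powr_times_real mult_ac)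
  also have "integral\<^sup>L lborel \<dots> = of_real c powr (s - 1) * mellin (\<lambda>u. of_real (exp (- c * u))) s"
    unfolding mellin_def set_lebesgue_integral_def by (rule Bochner_Integration.integral_mult_right_zero)
  also have "c *\<^sub>R \<dots> = of_real c powr s * mellin (\<lambda>u. of_real (exp (- c * u))) s"
    using c by (simp add: scaleR_conv_of_real powr_diff)
  finally show ?thesis using c by simp
qed

lemma mellin_by_parts:
  assumes deriv: "\<And>u. u > 0 \<Longrightarrow> (h has_vector_derivative h' u) (at u)"
    and meas [measurable]: "h \<in> borel_measurable borel" and cont: "continuous_on UNIV h'"
    and bound: "\<And>u. u > 0 \<Longrightarrow> norm (h u) \<le> C * exp (- u)"
    and bound': "\<And>u. u > 0 \<Longrightarrow> norm (h' u) \<le> C' * exp (- u)"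
    and s: "Re s > 0"
  shows "s * mellin h s = - mellin h' (s + 1)"
proof -
  have [measurable]: "h' \<in> borel_measurable borel"
    by (rule borel_measurable_continuous_onI[OF cont])
  define F where "F = (\<lambda>u. complex_of_real u powr s * h u)"
  define f where "f = (\<lambda>u. s * (complex_of_real u powr (s - 1) * h u) + complex_of_real u powr s * h' u)"
  have int1: "set_integrable lborel {0<..} (\<lambda>u. complex_of_real u powr (s - 1) * h u)"
    by (rule mellin_integrable[of _ C 0]) (use s bound in auto)
  have int2: "set_integrable lborel {0<..} (\<lambda>u. complex_of_real u powr (s + 1 - 1) * h' u)"
    by (rule mellin_integrable[of _ C' 0]) (use s bound' in auto)
  have int: "set_integrable lborel {0<..} f"
    unfolding f_def using int1 int2 by (intro set_integral_add set_integrable_mult_right) auto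
  have einterval: "einterval 0 \<infinity> = {0<..}"
    by (auto simp: einterval_def)
  have norm_F: "norm (F u) \<le> C * (u powr Re s * exp (- u))" if "u > 0" for u
    using bound[OF that] that by (auto simp: F_def norm_mult norm_of_real_powr mult.left_commute intro!: mult_left_mono)
  have "(LBINT u=0..\<infinity>. f u) = 0 - 0"
  proof (rule interval_integral_FTC_integrable)
    fix u :: real assume "0 < ereal u"
    hence u: "u > 0" by simp
    have "((\<lambda>u. complex_of_real u powr s) has_vector_derivative s * complex_of_real u powr (s - 1) * 1) (at u)"
      using has_vector_derivative_real_field[OF has_field_derivative_powr[of "complex_of_real u" s]] u
      by (auto simp: complex_nonpos_Reals_iff)
    hence "(F has_vector_derivative complex_of_real u powr s * h' u + s * complex_of_real u powr (s - 1) * 1 * h u) (at u)"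
      unfolding F_def by (intro has_vector_derivative_mult deriv u)
    thus "(F has_vector_derivative f u) (at u)"
      by (simp add: f_def algebra_simps)
    have "isCont h u"
      using deriv[OF u] by (rule has_vector_derivative_continuous)
    moreover have "isCont h' u"
      using cont by (simp add: continuous_on_eq_continuous_at)
    moreover have "isCont (\<lambda>u. complex_of_real u powr z) u" for z
      using u has_vector_derivative_continuous[OF has_vector_derivative_real_field[OF
          has_field_derivative_powr[of "complex_of_real u" z]]]
      by (auto simp: complex_nonpos_Reals_iff)
    ultimately show "isCont f u"
      unfolding f_def by (intro isCont_add isCont_mult continuous_const)
  next
    have "((\<lambda>u. C * (u powr Re s * exp (- u))) \<longlongrightarrow> 0) (at_right 0)"
      using s by real_asymp
    hence "(F \<longlongrightarrow> 0) (at_right 0)"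
      by (rule Lim_null_comparison[rotated]) (auto intro!: norm_F eventually_mono[OF eventually_at_right_less])
    thus "((F \<circ> real_of_ereal) \<longlongrightarrow> 0) (at_right 0)"
      by (simp add: ereal_tendsto_simps zero_ereal_def)
    have "((\<lambda>u. C * (u powr Re s * exp (- u))) \<longlongrightarrow> 0) at_top"
      using s by real_asymp
    hence "(F \<longlongrightarrow> 0) at_top"
      by (rule Lim_null_comparison[rotated]) (auto intro!: norm_F eventually_mono[OF eventually_gt_at_top[of 0]])
    thus "((F \<circ> real_of_ereal) \<longlongrightarrow> 0) (at_left \<infinity>)"
      by (simp add: ereal_tendsto_simps)
  qed (use int einterval in auto)
  hence "0 = (LINT u:{0<..}|lborel. f u)"
    by (simp add: interval_lebesgue_integral_def einterval)
  also have "\<dots> = s * mellin h s + mellin h' (s + 1)"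
    unfolding f_def mellin_def
    by (subst set_integral_add) (use int1 int2 in \<open>auto intro!: set_integrable_mult_right\<close>)
  finally show ?thesis by (simp add: add_eq_0_iff)
qed

section \<open>The entire alternating zeta function\<close>

text \<open>
  The Fermi--Dirac function, whose Mellin transform is \<open>\<Gamma>(s) \<zeta>\<^sup>*(s)\<close>.
\<close>

definition fermi :: "real \<Rightarrow> real" where
  "fermi u = 1 / (exp u + 1)"

lemma fermi_pos: "fermi u > 0"
  by (simp add: fermi_def add_pos_pos)

lemma fermi_le_exp: "fermi u \<le> exp (- u)"
  by (simp add: fermi_def exp_minus divide_simps add_pos_pos)

lemma fermi_le_1: "fermi u \<le> 1"
  by (simp add: fermi_def divide_simps add_pos_pos)

lemma fermi_altdef: "fermi u = exp (- u) / (1 + exp (- u))"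
  by (simp add: fermi_def exp_minus divide_simps add_pos_pos) 

lemma continuous_on_fermi [continuous_intros]: "continuous_on A fermi"
proof -
  have "exp u + 1 \<noteq> 0" for u :: real using exp_gt_zero[of u] by linarith
  thus ?thesis unfolding fermi_def by (intro continuous_intros) auto
qed

lemma measurable_fermi [measurable]: "fermi \<in> borel_measurable borel"
  by (intro borel_measurable_continuous_onI continuous_intros)

lemma has_real_derivative_fermi:
  "(fermi has_real_derivative - fermi u * (1 - fermi u)) (at u)"
proof -
  have "exp u + 1 \<noteq> 0" using exp_gt_zero[of u] by linarith
  thus ?thesis
    unfolding fermi_def by (auto intro!: derivative_eq_intros simp: field_simps)
qed

lemma alternating_exp_sum:
  "(\<Sum>n<N. (-1) ^ n * exp (- real (Suc n) * u)) = fermi u * (1 - (- exp (- u)) ^ N)"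
proof -
  have ne: "1 + exp (- u) \<noteq> 0" using exp_gt_zero[of "-u"] by linarith
  have "exp (- real (Suc n) * u) = exp (- u) * exp (- u) ^ n" for n
    by (simp flip: exp_of_nat_mult exp_add add: algebra_simps)
  hence "(\<Sum>n<N. (-1) ^ n * exp (- real (Suc n) * u)) = exp (- u) * (\<Sum>n<N. (- exp (- u)) ^ n)"
    by (simp add: sum_distrib_left power_minus[of "exp (- u)"] mult_ac)
  also have "(\<Sum>n<N. (- exp (- u)) ^ n) = (1 - (- exp (- u)) ^ N) / (1 + exp (- u))"
    using ne by (subst geometric_sum) (auto simp: field_simps)
  finally show ?thesis using ne by (simp add: fermi_altdef)
qed

text \<open>
  The partial sums of \<open>\<Sum>n. (-1)\<^sup>n exp (- (n + 1) u)\<close> are bounded by \<open>2 exp (- u)\<close>, so that the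
  series may be integrated term by term even where the Dirichlet series converges only
  conditionally.
\<close>

lemma alternating_series_sums_mellin_fermi:
  assumes s: "Re s > 0"
  shows "(\<lambda>n. (-1) ^ n / of_nat (Suc n) powr s) sums (rGamma s * mellin (\<lambda>u. of_real (fermi u)) s)"
proof -
  define S where "S = (\<lambda>N u. complex_of_real (\<Sum>n<N. (-1) ^ n * exp (- real (Suc n) * u)))"
  have Gamma_nz: "Gamma s \<noteq> 0"
    using not_nonpos_Int_if_Re_pos[OF s] by (simp add: Gamma_eq_zero_iff)
  have int: "set_integrable lborel {0<..} 
      (\<lambda>u. complex_of_real u powr (s - 1) * of_real (exp (- real (Suc n) * u)))" for n
    by (rule mellin_integrable[of _ 1 0]) (use s in \<open>auto simp: algebra_simps\<close>)
  have mellin_S: "mellin (S N) s = (\<Sum>n<N. (-1) ^ n * (Gamma s / of_nat (Suc n) powr s))" for N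
  proof -
    have "mellin (S N) s = (LINT u:{0<..}|lborel. (\<Sum>n<N. (-1) ^ n *
        (complex_of_real u powr (s - 1) * of_real (exp (- real (Suc n) * u)))))"
      unfolding mellin_def S_def
      by (intro set_lebesgue_integral_cong) (auto simp: sum_distrib_left mult_ac)
    also have "\<dots> = (\<Sum>n<N. LINT u:{0<..}|lborel. (-1) ^ n *
        (complex_of_real u powr (s - 1) * of_real (exp (- real (Suc n) * u))))"
      unfolding set_lebesgue_integral_def scaleR_sum_right
      using set_integrable_mult_right[OF int] unfolding set_integrable_def
      by (intro Bochner_Integration.integral_sum) blast
    also have "\<dots> = (\<Sum>n<N. (-1) ^ n * mellin (\<lambda>u. of_real (exp (- real (Suc n) * u))) s)"
      unfolding mellin_def by (intro sum.cong refl set_integral_mult_right)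
    also have "\<dots> = (\<Sum>n<N. (-1) ^ n * (Gamma s / of_nat (Suc n) powr s))"
    proof (intro sum.cong refl)
      fix n
      show "(-1) ^ n * mellin (\<lambda>u. of_real (exp (- real (Suc n) * u))) s = (-1) ^ n * (Gamma s / of_nat (Suc n) powr s)"
        using mellin_exp_scaled[OF s, of "real (Suc n)"] by simp
    qed
    finally show ?thesis .
  qed
  have "(\<lambda>N. mellin (S N) s) \<longlonglongrightarrow> mellin (\<lambda>u. of_real (fermi u)) s"
    unfolding mellin_def set_lebesgue_integral_def
  proof (rule integral_dominated_convergence)
    show "(\<lambda>u. indicator {0<..} u *\<^sub>R (complex_of_real u powr (s - 1) * of_real (fermi u))) \<in> borel_measurable lborel"
      using set_borel_measurable_mellin[of "\<lambda>u. of_real (fermi u)" "s - 1"] unfolding set_borel_measurable_def by simp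
    show "(\<lambda>u. indicator {0<..} u *\<^sub>R (complex_of_real u powr (s - 1) * S N u)) \<in> borel_measurable lborel" for N
      using set_borel_measurable_mellin[of "S N" "s - 1"] unfolding set_borel_measurable_def S_def by simp
    show "integrable lborel (\<lambda>u. indicator {0<..} u *\<^sub>R (2 * norm (complex_of_real u powr (s - 1) * of_real (exp (- u)))))"
      using set_integrable_mult_right[of 2, OF set_integrable_norm[OF set_integrable_Gamma[OF s]]]
      unfolding set_integrable_def by simp
    show "AE u in lborel. (\<lambda>N. indicator {0<..} u *\<^sub>R (complex_of_real u powr (s - 1) * S N u))
            \<longlonglongrightarrow> indicator {0<..} u *\<^sub>R (complex_of_real u powr (s - 1) * of_real (fermi u))"
    proof (intro AE_I2)
      fix u :: real
      have "(\<lambda>N. S N u) \<longlonglongrightarrow> of_real (fermi u * (1 - 0))" if "u > 0"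
        unfolding S_def alternating_exp_sum using that
        by (intro tendsto_of_real tendsto_intros LIMSEQ_power_zero) auto
      thus "(\<lambda>N. indicator {0<..} u *\<^sub>R (complex_of_real u powr (s - 1) * S N u))
            \<longlonglongrightarrow> indicator {0<..} u *\<^sub>R (complex_of_real u powr (s - 1) * of_real (fermi u))"
        by (cases "u > 0") (auto intro!: tendsto_intros)
    qed
    show "AE u in lborel. norm (indicator {0<..} u *\<^sub>R (complex_of_real u powr (s - 1) * S N u))
            \<le> indicator {0<..} u *\<^sub>R (2 * norm (complex_of_real u powr (s - 1) * of_real (exp (- u))))" for N
    proof (intro AE_I2)
      fix u :: real
      have "norm (S N u) \<le> 2 * exp (- u)" if "u > 0"
      proof -
        have "\<bar>1 - (- exp (- u)) ^ N\<bar> \<le> 1 + \<bar>(- exp (- u)) ^ N\<bar>" by linarith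
        also have "\<bar>(- exp (- u)) ^ N\<bar> \<le> 1"
          using that by (simp add: power_abs power_le_one)
        finally have "\<bar>fermi u * (1 - (- exp (- u)) ^ N)\<bar> \<le> exp (- u) * 2"
          unfolding abs_mult using fermi_pos[of u] fermi_le_exp[of u] by (intro mult_mono) auto
        thus ?thesis unfolding S_def alternating_exp_sum norm_of_real by simp
      qed
      thus "norm (indicator {0<..} u *\<^sub>R (complex_of_real u powr (s - 1) * S N u))
            \<le> indicator {0<..} u *\<^sub>R (2 * norm (complex_of_real u powr (s - 1) * of_real (exp (- u))))"
        by (auto simp: indicator_def norm_mult intro!: mult_left_mono)
    qed
  qed
  hence "(\<lambda>N. rGamma s * mellin (S N) s) \<longlonglongrightarrow> rGamma s * mellin (\<lambda>u. of_real (fermi u)) s"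
    by (intro tendsto_intros)
  moreover have "rGamma s * mellin (S N) s = (\<Sum>n<N. (-1) ^ n / of_nat (Suc n) powr s)" for N
    unfolding mellin_S sum_distrib_left using Gamma_nz by (intro sum.cong) (auto simp: rGamma_inverse_Gamma)
  ultimately show ?thesis by (simp add: sums_def)
qed

lemma continuous_on_poly_fermi: 
  "continuous_on A (\<lambda>u. poly Q (complex_of_real (fermi u)))"
  by (intro continuous_intros)

lemma measurable_poly_fermi [measurable]:
  "(\<lambda>u. poly Q (complex_of_real (fermi u))) \<in> borel_measurable borel"
  by (intro borel_measurable_continuous_onI continuous_on_poly_fermi)

lemma poly_fermi_bound:
  fixes Q :: "complex poly"
  assumes "poly Q 0 = 0"
  obtains C where "\<And>u. norm (poly Q (of_real (fermi u))) \<le> C * exp (- u)"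
proof -
  obtain R where Q: "Q = pCons 0 R"
    using assms by (metis pCons_cases poly_0_coeff_0 coeff_pCons_0)
  have "compact ((\<lambda>x::real. poly R (of_real x)) ` {0..1})"
    by (intro compact_continuous_image continuous_intros) auto
  then obtain C where C: "\<And>x::real. x \<in> {0..1} \<Longrightarrow> norm (poly R (of_real x)) \<le> C"
    by (metis bounded_iff compact_imp_bounded imageI)
  have "norm (poly Q (of_real (fermi u))) \<le> C * exp (- u)" for u
  proof -
    have "norm (poly Q (of_real (fermi u))) = fermi u * norm (poly R (of_real (fermi u)))"
      using fermi_pos[of u] by (simp add: Q norm_mult)
    also have "\<dots> \<le> exp (- u) * C"
      using fermi_pos[of u] fermi_le_exp[of u] fermi_le_1[of u] C[of "fermi u"]
      by (intro mult_mono) auto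
    finally show ?thesis by (simp add: mult.commute)
  qed
  thus ?thesis using that by blast
qed

text \<open>
  Since \<open>w = fermi u\<close> satisfies \<open>w' = - w (1 - w)\<close>, the functions \<open>Q(w)\<close> with \<open>Q\<close> a polynomial
  vanishing at \<open>0\<close> are closed under differentiation. Integration by parts and
  \<open>s / \<Gamma>(s + 1) = 1 / \<Gamma>(s)\<close> thus express the normalised transform of \<open>Q(w)\<close> at \<open>s\<close> by that of
  another such function at \<open>s + 1\<close>, so each step extends the half-plane by one unit.
\<close>

lemma rGamma_mellin_poly_fermi_extends:
  fixes Q :: "complex poly"
  assumes "poly Q 0 = 0"
  shows "\<exists>g. g holomorphic_on {s. Re s > - real k} \<and>
           (\<forall>s. Re s > 0 \<longrightarrow> g s = rGamma s * mellin (\<lambda>u. poly Q (of_real (fermi u))) s)"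
  using assms
proof (induction k arbitrary: Q)
  case (0 Q)
  obtain C where C: "\<And>u. norm (poly Q (of_real (fermi u))) \<le> C * exp (- u)"
    using poly_fermi_bound[OF 0] by blast
  have "mellin (\<lambda>u. poly Q (of_real (fermi u))) holomorphic_on {s. Re s > - 0}"
    by (rule mellin_holomorphic[of _ C]) (use C in auto)
  hence "(\<lambda>s. rGamma s * mellin (\<lambda>u. poly Q (of_real (fermi u))) s) holomorphic_on {s. Re s > - real 0}"
    by (auto intro!: holomorphic_intros)
  thus ?case by blast
next
  case (Suc k Q)
  define Q' where "Q' = [:0, -1, 1:] * pderiv Q"
  have Q': "poly Q' 0 = 0" by (simp add: Q'_def)
  obtain C where C: "\<And>u. norm (poly Q (of_real (fermi u))) \<le> C * exp (- u)"
    using poly_fermi_bound[OF Suc.prems] by blast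
  obtain C' where C': "\<And>u. norm (poly Q' (of_real (fermi u))) \<le> C' * exp (- u)"
    using poly_fermi_bound[OF Q'] by blast
  obtain g where g: "g holomorphic_on {s. Re s > - real k}"
      "\<And>s. Re s > 0 \<Longrightarrow> g s = rGamma s * mellin (\<lambda>u. poly Q' (of_real (fermi u))) s"
    using Suc.IH[OF Q'] by blast
  have "(\<lambda>s. - g (s + 1)) holomorphic_on {s. Re s > - real (Suc k)}"
    by (intro holomorphic_intros holomorphic_on_compose_gen[OF _ g(1), unfolded o_def]) auto
  moreover have "- g (s + 1) = rGamma s * mellin (\<lambda>u. poly Q (of_real (fermi u))) s" if s: "Re s > 0" for s
  proof -
    have "s * mellin (\<lambda>u. poly Q (of_real (fermi u))) s = - mellin (\<lambda>u. poly Q' (of_real (fermi u))) (s + 1)"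
    proof (rule mellin_by_parts)
      fix u :: real
      have "((\<lambda>u. complex_of_real (fermi u)) has_vector_derivative of_real (- fermi u * (1 - fermi u))) (at u)"
        using has_real_derivative_fermi[of u]
        by (intro has_vector_derivative_of_real) (simp add: has_real_derivative_iff_has_vector_derivative)
      hence "(((\<lambda>x. poly Q x) \<circ> (\<lambda>u. complex_of_real (fermi u))) has_vector_derivative 
         of_real (- fermi u * (1 - fermi u)) * poly (pderiv Q) (of_real (fermi u))) (at u)"
        by (rule field_vector_diff_chain_at) (rule poly_DERIV)
      thus "((\<lambda>u. poly Q (of_real (fermi u))) has_vector_derivative poly Q' (of_real (fermi u))) (at u)"
        by (simp add: o_def Q'_def algebra_simps)
    qed (use C C' s in \<open>auto simp: continuous_on_poly_fermi\<close>)
    hence "- g (s + 1) = rGamma (s + 1) * (s * mellin (\<lambda>u. poly Q (of_real (fermi u))) s)"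
      using g(2)[of "s + 1"] s by simp
    also have "\<dots> = (s * rGamma (s + 1)) * mellin (\<lambda>u. poly Q (of_real (fermi u))) s"
      by (simp only: mult_ac)
    finally show ?thesis by (simp only: rGamma_plus1)
  qed
  ultimately show ?case by blast
qed

lemma exists_entire_extension_of_half_plane:
  assumes "\<And>k. \<exists>g. g holomorphic_on {s. Re s > - real k} \<and> (\<forall>s. Re s > 0 \<longrightarrow> g s = f s)"
  shows "\<exists>F. F holomorphic_on UNIV \<and> (\<forall>s. Re s > 0 \<longrightarrow> F s = f s)"
proof -
  define U where "U = (\<lambda>k. {s. Re s > - real k})"
  obtain G where G: "\<And>k. G k holomorphic_on U k" "\<And>k s. Re s > 0 \<Longrightarrow> G k s = f s"
    unfolding U_def using assms by metis
  have open_U: "open (U k)" and conn_U: "connected (U k)" for k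
    by (auto simp: U_def open_halfspace_Re_gt intro!: convex_connected convex_halfspace_Re_gt)
  have agree: "G k s = G l s" if "k \<le> l" "s \<in> U k" for k l s
  proof (rule analytic_continuation_open[where s = "{s. Re s > 0}" and s' = "U k" and f = "G k" and g = "G l"])
    show "G l holomorphic_on U k"
      using G(1)[of l] by (rule holomorphic_on_subset) (use that in \<open>auto simp: U_def\<close>)
    show "{s::complex. Re s > 0} \<noteq> {}" by (auto intro!: exI[of _ 1])
    show "{s. Re s > 0} \<subseteq> U k" by (auto simp: U_def)
  qed (use G that(2) open_U conn_U in \<open>simp_all add: open_halfspace_Re_gt\<close>)
  have ex: "\<exists>k. s \<in> U k" for s
    using reals_Archimedean2[of "- Re s"] by (auto simp: U_def minus_less_iff)
  define F where "F = (\<lambda>s. G (LEAST k. s \<in> U k) s)"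
  have F_eq: "F s = G k s" if "s \<in> U k" for s k
    unfolding F_def using that ex by (intro agree Least_le) (auto intro: LeastI)
  have "F holomorphic_on (\<Union>k. U k)"
    using G(1) open_U by (intro holomorphic_on_UN_open) (auto simp: F_eq cong: holomorphic_cong)
  moreover have "(\<Union>k. U k) = UNIV" using ex by auto
  moreover have "F s = f s" if "Re s > 0" for s
    using F_eq[of s 0] G(2)[OF that] that by (simp add: U_def)
  ultimately show ?thesis by auto
qed

text \<open>
  The definition of \<^const>\<open>alt_zeta\<close> by a description operator is justified here: existence comes
  from the continued Mellin transform and uniqueness from the identity theorem.
\<close>

lemma alt_zeta_properties:
  shows holomorphic_alt_zeta: "alt_zeta holomorphic_on UNIV"
    and alt_zeta_sums: "Re s > 0 \<Longrightarrow> (\<lambda>n. (-1) ^ n / of_nat (Suc n) powr s) sums alt_zeta s"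
proof -
  let ?P = "\<lambda>f. f holomorphic_on UNIV \<and> 
     (\<forall>s. Re s > 0 \<longrightarrow> (\<lambda>n. (-1) ^ n / of_nat (Suc n) powr s) sums f s)"
  obtain F where F: "F holomorphic_on UNIV"
      "\<And>s. Re s > 0 \<Longrightarrow> F s = rGamma s * mellin (\<lambda>u. of_real (fermi u)) s"
    using exists_entire_extension_of_half_plane[OF rGamma_mellin_poly_fermi_extends[of "[:0, 1:]"]]
    by auto
  have PF: "?P F" using F alternating_series_sums_mellin_fermi by auto
  moreover have "G = F" if "?P G" for G
  proof
    fix z
    show "G z = F z"
    proof (rule analytic_continuation_open[where s = "{s. Re s > 0}" and s' = UNIV and f = G and g = F])
      show "{s::complex. Re s > 0} \<noteq> {}" by (auto intro!: exI[of _ 1])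
      show "G s = F s" if "s \<in> {s. Re s > 0}" for s
        using that PF \<open>?P G\<close> by (auto intro: sums_unique2)
    qed (use PF that open_halfspace_Re_gt[of 0] in auto)
  qed
  ultimately have "?P alt_zeta"
    unfolding alt_zeta_def by (rule theI)
  thus "alt_zeta holomorphic_on UNIV" 
       "Re s > 0 \<Longrightarrow> (\<lambda>n. (-1) ^ n / of_nat (Suc n) powr s) sums alt_zeta s" by auto
qed

lemma mellin_fermi:
  assumes "Re s > 0"
  shows "mellin (\<lambda>u. of_real (fermi u)) s = Gamma s * alt_zeta s"
proof -
  have "alt_zeta s = rGamma s * mellin (\<lambda>u. of_real (fermi u)) s"
    using alt_zeta_sums[OF assms] alternating_series_sums_mellin_fermi[OF assms] by (rule sums_unique2)
  moreover have "Gamma s \<noteq> 0"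
    using not_nonpos_Int_if_Re_pos[OF assms] by (simp add: Gamma_eq_zero_iff)
  ultimately show ?thesis by (simp add: rGamma_inverse_Gamma)
qed

section \<open>The distribution of the logarithm of a product\<close>

text \<open>
  If \<open>X\<close> is uniformly distributed on the unit interval, then \<open>- ln X\<close> is exponentially distributed.
  The half-open interval is chosen to match the square below.
\<close>

lemma distributed_neg_ln_uniform:
  "distributed (uniform_measure lborel {0<..1::real}) lborel (\<lambda>x. - ln x) (exponential_density 1)"
proof (rule exponential_distributedI)
  fix a :: real assume a: "0 \<le> a"
  have eq: "{0<..1} \<inter> {x::real. - ln x \<le> a} = {exp (- a)..1}"
    using a by (auto simp: ln_ge_iff minus_le_iff less_le_trans[OF exp_gt_zero])
  have "{x::real. - ln x \<le> a} \<in> sets lborel" by measurable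
  thus "emeasure (uniform_measure lborel {0<..1::real})
     {x \<in> space (uniform_measure lborel {0<..1}). - ln x \<le> a} = 1 - ennreal (exp (- a * 1))"
    using a divide_ennreal[of "1 - exp (- a)" 1]
    by (simp add: eq ennreal_minus flip: ennreal_1)
qed auto

lemma nn_integral_neg_ln:
  fixes g :: "real \<Rightarrow> ennreal"
  assumes [measurable]: "g \<in> borel_measurable borel"
  shows "(\<integral>\<^sup>+x. indicator {0<..1} x * g (- ln x) \<partial>lborel)
           = (\<integral>\<^sup>+u. indicator {0<..} u * ennreal (exp (- u)) * g u \<partial>lborel)"
proof -
  let ?M = "uniform_measure lborel {0<..1::real}"
  have "(\<integral>\<^sup>+x. indicator {0<..1} x * g (- ln x) \<partial>lborel) = (\<integral>\<^sup>+x. g (- ln x) \<partial>?M)"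
    by (subst nn_integral_uniform_measure) (auto simp: mult.commute divide_ennreal_def)
  also have "\<dots> = (\<integral>\<^sup>+u. g u \<partial>distr ?M lborel (\<lambda>x. - ln x))"
    by (subst nn_integral_distr) auto
  also have "\<dots> = (\<integral>\<^sup>+u. ennreal (exponential_density 1 u) * g u \<partial>lborel)"
    unfolding distributed_distr_eq_density[OF distributed_neg_ln_uniform]
    by (subst nn_integral_density) auto
  also have "\<dots> = (\<integral>\<^sup>+u. indicator {0<..} u * ennreal (exp (- u)) * g u \<partial>lborel)"
    by (intro nn_integral_cong_AE eventually_mono[OF AE_lborel_singleton[of 0]])
       (auto simp: exponential_density_def indicator_def)
  finally show ?thesis .
qed

lemma integral_one_minus_exp:
  assumes "u > 0"
  shows "(\<integral>\<^sup>+a. ennreal ((1 - exp (- a)) * indicator {0..u} a) \<partial>lborel) = ennreal (u - 1 + exp (- u))"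
proof -
  have "(\<integral>\<^sup>+a. ennreal (1 - exp (- a)) * indicator {0..u} a \<partial>lborel)
      = ennreal ((u + exp (- u)) - (0 + exp (- 0)))"
    by (rule nn_integral_FTC_Icc) (use assms in \<open>auto intro!: derivative_eq_intros\<close>)
  also have "(\<integral>\<^sup>+a. ennreal (1 - exp (- a)) * indicator {0..u} a \<partial>lborel)
      = (\<integral>\<^sup>+a. ennreal ((1 - exp (- a)) * indicator {0..u} a) \<partial>lborel)"
    by (intro nn_integral_cong) (auto simp: indicator_def)
  finally show ?thesis by (simp add: algebra_simps)
qed

text \<open>
  The weight \<open>1 - x\<close> on the unit square. The sides \<open>x = 0\<close> and \<open>y = 0\<close> are left out because there
  the integrand of the theorem is zero, owing to \<open>ln 0 = 0\<close>; with this choice the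
  integrand factors through \<open>- ln (x y)\<close> at every point of the closed square.
\<close>

definition square_weight :: "real \<times> real \<Rightarrow> real" where
  "square_weight p = indicator ({0<..1} \<times> {0<..1}) p * (1 - fst p)"

text \<open>
  The density of the image of this weight under \<open>(x, y) \<mapsto> - ln (x y)\<close>.
\<close>

definition log_density :: "real \<Rightarrow> real" where
  "log_density u = indicator {0<..} u * (exp (- u) * (u - 1 + exp (- u)))"

lemma measurable_square_weight [measurable]: "square_weight \<in> borel_measurable borel"
  unfolding square_weight_def by (subst borel_prod[symmetric]) measurable

lemma measurable_log_density [measurable]: "log_density \<in> borel_measurable borel"
  unfolding log_density_def by measurable

lemma measurable_neg_ln_mult [measurable]:
  "(\<lambda>p::real \<times> real. - ln (fst p * snd p)) \<in> borel_measurable borel"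
  by (subst borel_prod[symmetric]) measurable

text \<open>
  With \<open>a = - ln x\<close> and \<open>b = - ln y\<close> the measure becomes
  \<open>(1 - exp (- a)) exp (- a) exp (- b) da db\<close>, and the density of \<open>u = a + b\<close> is the convolution
  \<open>exp (- u) \<integral>\<^sub>0\<^sup>u (1 - exp (- a)) da\<close>.
\<close>

lemma nn_integral_square_neg_ln_mult:
  fixes g :: "real \<Rightarrow> ennreal"
  assumes [measurable]: "g \<in> borel_measurable borel"
  shows "(\<integral>\<^sup>+p. ennreal (square_weight p) * g (- ln (fst p * snd p)) \<partial>lborel)
           = (\<integral>\<^sup>+u. ennreal (log_density u) * g u \<partial>lborel)"
proof -
  define E where "E = (\<lambda>u::real. indicator {0<..} u * ennreal (exp (- u)))"
  have [measurable]: "E \<in> borel_measurable borel" unfolding E_def by measurable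
  have [measurable]: "(\<lambda>p. ennreal (square_weight p) * g (- ln (fst p * snd p))) \<in> borel_measurable borel"
    by measurable
  have "(\<integral>\<^sup>+p. ennreal (square_weight p) * g (- ln (fst p * snd p)) \<partial>lborel)
     = (\<integral>\<^sup>+x. \<integral>\<^sup>+y. ennreal (square_weight (x, y)) * g (- ln (x * y)) \<partial>lborel \<partial>lborel)"
    by (subst lborel_prod[symmetric], subst lborel.nn_integral_fst[symmetric])
       (auto simp: lborel_prod)
  also have "\<dots> = (\<integral>\<^sup>+x. indicator {0<..1} x * (ennreal (1 - exp (- (- ln x))) * 
      (\<integral>\<^sup>+y. indicator {0<..1} y * g ((- ln x) + (- ln y)) \<partial>lborel)) \<partial>lborel)"
  proof (intro nn_integral_cong)
    fix x :: real
    have "(\<integral>\<^sup>+y. ennreal (square_weight (x, y)) * g (- ln (x * y)) \<partial>lborel)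
      = (\<integral>\<^sup>+y. indicator {0<..1} x * ennreal (1 - x) * (indicator {0<..1} y * g ((- ln x) + (- ln y))) \<partial>lborel)"
      by (intro nn_integral_cong) (auto simp: square_weight_def indicator_def ln_mult algebra_simps)
    also have "\<dots> = indicator {0<..1} x * ennreal (1 - x) * (\<integral>\<^sup>+y. indicator {0<..1} y * g ((- ln x) + (- ln y)) \<partial>lborel)"
      by (intro nn_integral_cmult) auto
    finally show "(\<integral>\<^sup>+y. ennreal (square_weight (x, y)) * g (- ln (x * y)) \<partial>lborel) =
       indicator {0<..1} x * (ennreal (1 - exp (- (- ln x))) * 
      (\<integral>\<^sup>+y. indicator {0<..1} y * g ((- ln x) + (- ln y)) \<partial>lborel))"
      by (auto simp: indicator_def)
  qed
  also have "\<dots> = (\<integral>\<^sup>+a. E a * (ennreal (1 - exp (- a)) * 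
      (\<integral>\<^sup>+y. indicator {0<..1} y * g (a + (- ln y)) \<partial>lborel)) \<partial>lborel)"
    unfolding E_def by (rule nn_integral_neg_ln) measurable
  also have "\<dots> = (\<integral>\<^sup>+a. E a * (ennreal (1 - exp (- a)) * (\<integral>\<^sup>+b. E b * g (a + b) \<partial>lborel)) \<partial>lborel)"
  proof (intro nn_integral_cong)
    fix a :: real
    show "E a * (ennreal (1 - exp (- a)) * (\<integral>\<^sup>+y. indicator {0<..1} y * g (a + (- ln y)) \<partial>lborel))
       = E a * (ennreal (1 - exp (- a)) * (\<integral>\<^sup>+b. E b * g (a + b) \<partial>lborel))"
      unfolding E_def by (subst nn_integral_neg_ln) auto
  qed
  also have "\<dots> = (\<integral>\<^sup>+a. \<integral>\<^sup>+u. E a * ennreal (1 - exp (- a)) * (E (u - a) * g u) \<partial>lborel \<partial>lborel)"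
  proof (intro nn_integral_cong)
    fix a :: real
    have "(\<integral>\<^sup>+b. E b * g (a + b) \<partial>lborel) = (\<integral>\<^sup>+u. E (u - a) * g u \<partial>lborel)"
      by (subst nn_integral_real_affine[where c = 1 and t = "a" and f = "\<lambda>u. E (u - a) * g u"]) auto
    thus "E a * (ennreal (1 - exp (- a)) * (\<integral>\<^sup>+b. E b * g (a + b) \<partial>lborel)) =
       (\<integral>\<^sup>+u. E a * ennreal (1 - exp (- a)) * (E (u - a) * g u) \<partial>lborel)"
      by (simp add: nn_integral_cmult mult.assoc)
  qed
  also have "\<dots> = (\<integral>\<^sup>+u. \<integral>\<^sup>+a. E a * ennreal (1 - exp (- a)) * (E (u - a) * g u) \<partial>lborel \<partial>lborel)"
    by (rule lborel_pair.Fubini'[symmetric]) measurable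
  also have "\<dots> = (\<integral>\<^sup>+u. ennreal (log_density u) * g u \<partial>lborel)"
  proof (intro nn_integral_cong)
    fix u :: real
    have "(\<integral>\<^sup>+a. E a * ennreal (1 - exp (- a)) * (E (u - a) * g u) \<partial>lborel)
        = (\<integral>\<^sup>+a. ennreal (exp (- u)) * g u * ennreal ((1 - exp (- a)) * indicator {0<..<u} a) \<partial>lborel)"
    proof (intro nn_integral_cong)
      fix a :: real
      have "ennreal (exp (- a)) * ennreal (exp (- (u - a))) = ennreal (exp (- u))"
        by (simp flip: ennreal_mult'' exp_add)
      thus "E a * ennreal (1 - exp (- a)) * (E (u - a) * g u) =
        ennreal (exp (- u)) * g u * ennreal ((1 - exp (- a)) * indicator {0<..<u} a)"
        by (auto simp: E_def indicator_def mult_ac) (simp flip: mult.assoc)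
    qed
    also have "\<dots> = ennreal (exp (- u)) * g u * (\<integral>\<^sup>+a. ennreal ((1 - exp (- a)) * indicator {0<..<u} a) \<partial>lborel)"
      by (intro nn_integral_cmult) auto
    also have "(\<integral>\<^sup>+a. ennreal ((1 - exp (- a)) * indicator {0<..<u} a) \<partial>lborel)
        = indicator {0<..} u * ennreal (u - 1 + exp (- u))"
    proof (cases "u > 0")
      case True
      have "(\<integral>\<^sup>+a. ennreal ((1 - exp (- a)) * indicator {0<..<u} a) \<partial>lborel) 
          = (\<integral>\<^sup>+a. ennreal ((1 - exp (- a)) * indicator {0..u} a) \<partial>lborel)"
        by (intro nn_integral_cong_AE
              eventually_mono[OF eventually_conj[OF AE_lborel_singleton[of 0] AE_lborel_singleton[of u]]])
           (auto simp: indicator_def)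
      with True show ?thesis by (simp add: integral_one_minus_exp)
    qed auto
    finally show "(\<integral>\<^sup>+a. E a * ennreal (1 - exp (- a)) * (E (u - a) * g u) \<partial>lborel) = ennreal (log_density u) * g u"
      by (auto simp: log_density_def indicator_def ennreal_mult' mult_ac)
  qed
  finally show ?thesis .
qed

lemma distr_square_neg_ln_mult:
  "distr (density lborel square_weight) borel (\<lambda>p. - ln (fst p * snd p)) = density lborel log_density"
proof (rule measure_eqI)
  fix A assume "A \<in> sets (distr (density lborel square_weight) borel (\<lambda>p. - ln (fst p * snd p)))"
  hence [measurable]: "A \<in> sets borel" by simp
  let ?T = "\<lambda>p::real \<times> real. - ln (fst p * snd p)"
  have [measurable]: "?T -` A \<in> sets borel"
    using measurable_sets_borel[OF measurable_neg_ln_mult, of A] by simp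
  have "emeasure (distr (density lborel square_weight) borel ?T) A 
     = (\<integral>\<^sup>+p. ennreal (square_weight p) * indicator A (?T p) \<partial>lborel)"
    by (subst emeasure_distr; (subst emeasure_density)?)
       (auto intro!: nn_integral_cong measurable_neg_ln_mult simp: indicator_def simp del: borel_measurable_uminus_eq)
  also have "\<dots> = emeasure (density lborel log_density) A"
    by (subst nn_integral_square_neg_ln_mult) (auto simp: emeasure_density)
  finally show "emeasure (distr (density lborel square_weight) borel ?T) A 
     = emeasure (density lborel log_density) A" .
qed auto

section \<open>The double integral as a Mellin transform\<close>

text \<open>
  The function whose Mellin transform, taken at \<open>s + 1\<close>, is the double integral.
\<close>

definition fermi_kernel :: "real \<Rightarrow> complex" where
  "fermi_kernel u = of_real (fermi u * (u - 1 + exp (- u)))"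

lemma measurable_fermi_kernel [measurable]: "fermi_kernel \<in> borel_measurable borel"
  unfolding fermi_kernel_def by measurable

text \<open>
  The quadratic decay at \<open>0\<close> is what moves the abscissa of convergence of the double integral to
  \<open>-3\<close>.
\<close>

lemma fermi_kernel_bound:
  assumes "u > 0"
  shows "norm (fermi_kernel u) \<le> 1 * u powr 2 * exp (- u)"
proof -
  have nonneg: "u - 1 + exp (- u) \<ge> 0"
    using exp_ge_add_one_self[of "- u"] by linarith
  have "exp (- u) \<le> 1 / (1 + u)"
    using exp_ge_add_one_self[of u] assms by (auto simp: exp_minus divide_simps add.commute)
  also have "\<dots> \<le> 1 - u + u\<^sup>2"
  proof -
    have "(1 - u + u\<^sup>2) * (1 + u) = 1 + u ^ 3"
      by (simp add: algebra_simps power2_eq_square power3_eq_cube)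
    moreover have "u ^ 3 \<ge> 0" using assms by simp
    ultimately show ?thesis using assms by (simp add: pos_divide_le_eq)
  qed
  finally have "u - 1 + exp (- u) \<le> u\<^sup>2" by simp
  hence "fermi u * (u - 1 + exp (- u)) \<le> exp (- u) * u\<^sup>2"
    using fermi_pos[of u] nonneg by (intro mult_mono fermi_le_exp) auto
  moreover have "fermi u * (u - 1 + exp (- u)) \<ge> 0"
    using fermi_pos[of u] nonneg by simp
  ultimately show ?thesis
    using assms by (simp add: fermi_kernel_def powr_numeral mult.commute del: of_real_mult)
qed

lemma square_integral_eq_mellin_fermi_kernel:
  assumes s: "Re s > -3"
  shows "set_integrable lborel ({0..1} \<times> {0..1}) (square_integrand s)"
    and "(LINT p:{0..1} \<times> {0..1}|lborel. square_integrand s p) = mellin fermi_kernel (s + 1)"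
proof -
  define T where "T = (\<lambda>p::real \<times> real. - ln (fst p * snd p))"
  have T [measurable]: "T \<in> borel_measurable borel"
    unfolding T_def by (rule measurable_neg_ln_mult)
  define F where "F = (\<lambda>u. (indicator {0<..} u *\<^sub>R (complex_of_real u powr s)) * of_real (1 / (1 + exp (- u))))"
  have F [measurable]: "F \<in> borel_measurable borel"
    unfolding F_def by measurable
  let ?I = "\<lambda>p. indicator ({0..1} \<times> {0..1}) p *\<^sub>R square_integrand s p"
  have I_eq: "?I p = square_weight p *\<^sub>R F (T p)" for p
  proof (cases p)
    case (Pair x y)
    show ?thesis
    proof (cases "0 < x \<and> x \<le> 1 \<and> 0 < y \<and> y \<le> 1 \<and> x * y < 1")
      case True
      hence "ln (x * y) < 0" by simp
      moreover have "exp (ln (x * y)) = x * y" using True by simp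
      ultimately show ?thesis
        using True unfolding Pair by (simp add: square_weight_def F_def T_def square_integrand_def scaleR_conv_of_real)
    next
      case False
      \<comment> \<open>Here \<open>x \<le> 0\<close> or \<open>y \<le> 0\<close> or \<open>x = 1\<close> or \<open>(x, y)\<close> lies outside the square; both sides vanish.\<close>
      have "x = 1 \<or> x * y < 1" if "0 < x" "x \<le> 1" "0 < y" "y \<le> 1"
        proof (cases "x < 1")
        case True
        hence "x * y < 1 * y" using that by (intro mult_strict_right_mono) auto
        also have "\<dots> \<le> 1" using that by simp
        finally show ?thesis ..
      qed (use that in auto)
      with False show ?thesis
        unfolding Pair by (auto simp: square_weight_def square_integrand_def indicator_def)
    qed
  qed
  have weight_nonneg: "square_weight p \<ge> 0" for p
    by (auto simp: square_weight_def indicator_def mem_Times_iff)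
  have density_nonneg: "log_density u \<ge> 0" for u
    using exp_ge_add_one_self[of "- u"] by (auto simp: log_density_def indicator_def intro!: mult_nonneg_nonneg)
  have density_F: "log_density u *\<^sub>R F u = indicator {0<..} u *\<^sub>R (complex_of_real u powr (s + 1 - 1) * fermi_kernel u)" for u
    by (auto simp: log_density_def F_def fermi_kernel_def fermi_altdef indicator_def scaleR_conv_of_real)
  have "integrable lborel ?I \<longleftrightarrow> integrable (density lborel square_weight) (\<lambda>p. F (T p))"
    unfolding I_eq using weight_nonneg by (subst integrable_density) auto
  also have "\<dots> \<longleftrightarrow> integrable (distr (density lborel square_weight) borel T) F"
    by (subst integrable_distr_eq) auto
  also have "\<dots> \<longleftrightarrow> integrable lborel (\<lambda>u. log_density u *\<^sub>R F u)"
    unfolding T_def distr_square_neg_ln_mult using density_nonneg by (subst integrable_density) auto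
  also have "\<dots> \<longleftrightarrow> set_integrable lborel {0<..} (\<lambda>u. complex_of_real u powr (s + 1 - 1) * fermi_kernel u)"
    unfolding density_F set_integrable_def ..
  finally show "set_integrable lborel ({0..1} \<times> {0..1}) (square_integrand s)"
    using mellin_integrable[OF measurable_fermi_kernel fermi_kernel_bound, of "s + 1"] s
    by (simp add: set_integrable_def)
  have "integral\<^sup>L lborel ?I = integral\<^sup>L (density lborel square_weight) (\<lambda>p. F (T p))"
    unfolding I_eq using weight_nonneg by (subst integral_density) auto
  also have "\<dots> = integral\<^sup>L (distr (density lborel square_weight) borel T) F"
    by (subst integral_distr) auto
  also have "\<dots> = integral\<^sup>L lborel (\<lambda>u. log_density u *\<^sub>R F u)"
    unfolding T_def distr_square_neg_ln_mult using density_nonneg by (subst integral_density) auto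
  also have "\<dots> = mellin fermi_kernel (s + 1)"
    unfolding density_F mellin_def set_lebesgue_integral_def ..
  finally show "(LINT p:{0..1} \<times> {0..1}|lborel. square_integrand s p) = mellin fermi_kernel (s + 1)"
    by (simp add: set_lebesgue_integral_def)
qed

text \<open>
  With \<open>w = fermi u\<close> one has \<open>w (1 - exp (- u)) = 2 w - exp (- u)\<close>, so the kernel is
  \<open>u w - 2 w + exp (- u)\<close>; in this half-plane the three transforms exist separately.
\<close>

lemma mellin_fermi_kernel_right_half_plane:
  assumes s: "Re s > -1"
  shows "mellin fermi_kernel (s + 1) = gamma_zeta_expr s"
proof -
  let ?w = "\<lambda>u. complex_of_real (fermi u)"
  have int: "set_integrable lborel {0<..} (\<lambda>u. complex_of_real u powr (z - 1) * ?w u)" if "Re z > 0" for z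
    by (rule mellin_integrable[of _ 1 0]) (use that fermi_le_exp fermi_pos in \<open>auto simp: abs_of_pos\<close>)
  have s1: "Re (s + 1) > 0" and s2: "Re (s + 2) > 0" using s by auto
  have kernel_eq: "complex_of_real u powr (s + 1 - 1) * fermi_kernel u
     = complex_of_real u powr (s + 2 - 1) * ?w u - 2 * (complex_of_real u powr (s + 1 - 1) * ?w u)
       + complex_of_real u powr (s + 1 - 1) * of_real (exp (- u))" if "u > 0" for u
  proof -
    have ne: "1 + exp (- u) \<noteq> 0" using exp_gt_zero[of "- u"] by linarith
    hence "fermi u + fermi u * exp (- u) = exp (- u)"
      by (simp add: fermi_altdef flip: add_divide_distrib) (simp add: field_simps)
    hence "fermi u * (u - 1 + exp (- u)) = u * fermi u - 2 * fermi u + exp (- u)"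
      by (simp add: algebra_simps)
    hence kernel_u: "fermi_kernel u = of_real (u * fermi u - 2 * fermi u + exp (- u))"
      by (simp only: fermi_kernel_def)
    have powr_u: "complex_of_real u powr (s + 2 - 1) = complex_of_real u powr s * of_real u"
      using that powr_add[of "complex_of_real u" s 1] by (simp add: add_diff_eq[symmetric])
    show ?thesis unfolding kernel_u powr_u by (simp add: algebra_simps)
  qed
  have "mellin fermi_kernel (s + 1) = (LINT u:{0<..}|lborel. 
     complex_of_real u powr (s + 2 - 1) * ?w u - 2 * (complex_of_real u powr (s + 1 - 1) * ?w u)
       + complex_of_real u powr (s + 1 - 1) * of_real (exp (- u)))"
    unfolding mellin_def by (rule set_lebesgue_integral_cong) (use kernel_eq in auto)
  also have "\<dots> = mellin ?w (s + 2) - 2 * mellin ?w (s + 1) + mellin (\<lambda>u. of_real (exp (- u))) (s + 1)"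
    unfolding mellin_def
    using int[OF s2] int[OF s1] set_integrable_Gamma[OF s1]
    by (simp only: set_integral_add(2) set_integral_diff set_integrable_mult_right set_integral_mult_right)
  also have "\<dots> = Gamma (s + 2) * alt_zeta (s + 2) - 2 * (Gamma (s + 1) * alt_zeta (s + 1)) + Gamma (s + 1)"
    by (simp only: mellin_fermi[OF s1] mellin_fermi[OF s2] mellin_exp[OF s1])
  also have "\<dots> = gamma_zeta_expr s"
  proof -
    have "s + 1 \<noteq> 0" using s1 by (metis less_irrefl zero_complex.sel(1))
    moreover have "Gamma (s + 2) = (s + 1) * Gamma (s + 1)"
      using Gamma_plus1[OF not_nonpos_Int_if_Re_pos[OF s1]] by (simp add: add.assoc)
    ultimately show ?thesis by (simp add: gamma_zeta_expr_def field_simps)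
  qed
  finally show ?thesis .
qed

lemma holomorphic_gamma_zeta_expr:
  "gamma_zeta_expr holomorphic_on {s. Re s > -3} - {-1, -2}"
proof -
  have "s + 2 \<notin> \<int>\<^sub>\<le>\<^sub>0" if "Re s > -3" "s \<noteq> -2" for s :: complex
  proof
    assume "s + 2 \<in> \<int>\<^sub>\<le>\<^sub>0"
    then obtain n where n: "s + 2 = of_int n" "n \<le> 0" by (auto elim!: nonpos_Ints_cases)
    have "Re (s + 2) = real_of_int n" using n by simp
    hence "n > -1" using that(1) by simp
    hence "n = 0" using n(2) by simp
    thus False using n that(2) by (simp add: add_eq_0_iff2)
  qed
  moreover have "s + 1 \<noteq> 0" if "s \<noteq> -1" for s :: complex using that by (simp add: add_eq_0_iff2)
  moreover have "(\<lambda>s. alt_zeta (s + c)) holomorphic_on A" for A c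
    using holomorphic_on_compose_gen[of "\<lambda>s. s + c" A alt_zeta UNIV] holomorphic_alt_zeta
    by (simp add: o_def holomorphic_on_add)
  ultimately show ?thesis
    unfolding gamma_zeta_expr_def
    by (intro holomorphic_on_mult holomorphic_on_add holomorphic_on_diff holomorphic_on_divide
          holomorphic_Gamma' holomorphic_on_const holomorphic_on_ident) auto
qed

theorem theorem1:
  fixes s :: complex
  assumes "Re s > -3"
  shows "set_integrable lborel ({0..1} \<times> {0..1}) (square_integrand s) \<and>
    (s \<noteq> -1 \<and> s \<noteq> -2 \<longrightarrow>
      (LINT p:{0..1} \<times> {0..1}|lborel. square_integrand s p) = gamma_zeta_expr s) \<and>
    (s = -1 \<or> s = -2 \<longrightarrow>
      (gamma_zeta_expr \<longlongrightarrow> (LINT p:{0..1} \<times> {0..1}|lborel. square_integrand s p)) (at s))"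
proof -
  define H where "H = {s :: complex. Re s > -3}"
  have H: "open H" "connected H"
    by (auto simp: H_def open_halfspace_Re_gt intro!: convex_connected convex_halfspace_Re_gt)
  have "mellin fermi_kernel holomorphic_on {s. Re s > - 2}"
    using mellin_holomorphic[OF measurable_fermi_kernel fermi_kernel_bound] .
  hence hol: "(\<lambda>s. mellin fermi_kernel (s + 1)) holomorphic_on H"
    using holomorphic_on_compose_gen[of "\<lambda>s. s + 1" H "mellin fermi_kernel" "{s. Re s > - 2}"]
    by (simp add: o_def H_def holomorphic_on_add image_subset_iff)
  have eq: "mellin fermi_kernel (z + 1) = gamma_zeta_expr z" if "z \<in> H - {-1, -2}" for z
  proof (rule analytic_continuation_open[where s = "{s. Re s > -1}" and s' = "H - {-1, -2}"
           and f = "\<lambda>z. mellin fermi_kernel (z + 1)"])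
    show "connected (H - {-1, -2})"
      using H by (intro connected_open_delete_finite) auto
    show "(\<lambda>z. mellin fermi_kernel (z + 1)) holomorphic_on H - {-1, -2}"
      using hol by (rule holomorphic_on_subset) auto
    show "gamma_zeta_expr holomorphic_on H - {-1, -2}"
      unfolding H_def by (rule holomorphic_gamma_zeta_expr)
    show "{s::complex. Re s > -1} \<noteq> {}" by (auto intro!: exI[of _ 0])
    show "mellin fermi_kernel (z + 1) = gamma_zeta_expr z" if "z \<in> {s. Re s > -1}" for z
      using that mellin_fermi_kernel_right_half_plane by simp
  qed (use H that in \<open>auto simp: H_def open_halfspace_Re_gt\<close>)
  have lim: "(gamma_zeta_expr \<longlongrightarrow> mellin fermi_kernel (s + 1)) (at s)"
  proof -
    have "isCont (\<lambda>z. mellin fermi_kernel (z + 1)) s"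
      using holomorphic_on_imp_continuous_on[OF hol] H assms
      by (simp add: continuous_on_eq_continuous_at H_def)
    hence "((\<lambda>z. mellin fermi_kernel (z + 1)) \<longlongrightarrow> mellin fermi_kernel (s + 1)) (at s)"
      by (simp add: isCont_def)
    moreover have "eventually (\<lambda>z. z \<in> H - {-1, -2} - {s}) (at s)"
    proof -
      have "open (H - ({-1, -2} - {s}))" using H by (intro open_Diff finite_imp_closed) auto
      hence "eventually (\<lambda>z. z \<in> H - ({-1, -2} - {s}) - {s}) (at s)"
        using assms by (intro eventually_at_in_open) (auto simp: H_def)
      thus ?thesis by eventually_elim auto
    qed
    hence "eventually (\<lambda>z. mellin fermi_kernel (z + 1) = gamma_zeta_expr z) (at s)"
      by eventually_elim (use eq in auto)
    ultimately show ?thesis by (rule Lim_transform_eventually)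
  qed
  show ?thesis
    using square_integral_eq_mellin_fermi_kernel[OF assms] eq[of s] lim assms by (auto simp: H_def)
qed

end
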